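(* Let $p$ be a prime, let $b,r$ be positive integers with $r\geq 2$, let $q=(p^b)^r$, and let $N=\frac{q^3+1}{q+1}$. Let $S$ be the numerical semigroup generated by $$\{\,q^3+1-iN-j \;:\; i,j\in\mathbb{Z}_{\geq 0},\ 0\leq i+j\leq p^b\,\}.$$ Then the genus of $S$ is $$g=\frac{q^5-q^3p^b-q^3+q^2}{2p^b},$$ and the conductor of $S$ is $$c=\frac{q^5-2q^3p^b+q^2p^{2b}-q^2p^b-qp^{2b}+q^2+qp^b+p^{2b}-p^b}{p^b}.$$
   Context: The gaps of a numerical semigroup are the non-negative integers not belonging to it; its genus is the number of gaps; its Frobenius number is its largest gap; its conductor is the non-gap right after the Frobenius number, i.e. the Frobenius number plus $1$. *)

theory Defs
  imports Complex_Main "HOL-Computational_Algebra.Primes"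
begin

definition numerical_semigroup :: "nat set \<Rightarrow> bool" where
  "numerical_semigroup S \<longleftrightarrow>
     0 \<in> S \<and> (\<forall>x\<in>S. \<forall>y\<in>S. x + y \<in> S) \<and> finite (UNIV - S)"

inductive_set generated_semigroup :: "nat set \<Rightarrow> nat set" for A :: "nat set" where
  zero: "0 \<in> generated_semigroup A"
| gen: "a \<in> A \<Longrightarrow> a \<in> generated_semigroup A"
| add: "x \<in> generated_semigroup A \<Longrightarrow> y \<in> generated_semigroup A
    \<Longrightarrow> x + y \<in> generated_semigroup A"

definition gaps :: "nat set \<Rightarrow> nat set" where
  "gaps S = UNIV - S"

(* Meaningful for finite gap sets only, since card of an infinite set is 0. *)
definition genus :: "nat set \<Rightarrow> nat" where
  "genus S = card (gaps S)"

(* Meaningful for finite nonempty gap sets only: Max is unspecified otherwise. *)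
definition frobenius_number :: "nat set \<Rightarrow> nat" where
  "frobenius_number S = Max (gaps S)"

definition conductor :: "nat set \<Rightarrow> nat" where
  "conductor S = frobenius_number S + 1"

(* The next two facts justify working in nat with N = (q ^ 3 + 1) div (q + 1) and
   with the generators q ^ 3 + 1 - i * N - j where i + j \<le> m = p ^ b \<le> q:
   the division is exact and the subtraction never truncates. *)

lemma div_exact_cube_plus_one:
  fixes q :: nat
  shows "(q ^ 3 + 1) div (q + 1) * (q + 1) = q ^ 3 + 1"
proof (cases q)
  case (Suc k)
  have "q ^ 3 + 1 = (q + 1) * (k * q + 1)"
    unfolding Suc by (simp add: power3_eq_cube algebra_simps)
  then have "q + 1 dvd q ^ 3 + 1" by (rule dvdI)
  then show ?thesis by (rule dvd_div_mult_self)
qed simp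

lemma generator_no_truncation:
  fixes q m i j :: nat
  assumes "m \<le> q" "i + j \<le> m"
  shows "i * ((q ^ 3 + 1) div (q + 1)) + j \<le> q ^ 3 + 1"
proof -
  define N where "N = (q ^ 3 + 1) div (q + 1)"
  have eq: "N * (q + 1) = q ^ 3 + 1"
    unfolding N_def by (rule div_exact_cube_plus_one)
  then have "N \<ge> 1" by (cases N) auto
  then have "j \<le> j * N" by simp
  then have "i * N + j \<le> (i + j) * N" by (simp add: algebra_simps)
  also have "\<dots> \<le> (q + 1) * N" using assms by (intro mult_right_mono) auto
  finally show ?thesis using eq by (simp add: N_def mult.commute)
qed

end

theory Submission
  imports Defs
begin

text \<open>
  Put \<open>m = p ^ b\<close>, \<open>q = m * h\<close> and \<open>L = q ^ 3 + 1 = (q + 1) * N\<close>. A sum of \<open>k\<close> generators is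
  \<open>k * L - i * N - j\<close>, and the pairs \<open>(i, j)\<close> that occur are exactly those with \<open>i + j \<le> k * m\<close>
  (\<open>generated_semigroup_iff\<close>). So a number \<open>n\<close> lies in \<open>S\<close> when, for some \<open>k\<close>, the
  distance from \<open>n\<close> up to \<open>k * L\<close> can be paid with at most \<open>k * m\<close> coins of value \<open>N\<close> and 1.

  Rounding a positive \<open>n\<close> up to a multiple of \<open>N\<close> and then to a multiple of \<open>L\<close> writes it
  uniquely as \<open>k * L - u * N - s\<close> with \<open>0 < k\<close>, \<open>u \<le> q\<close> and \<open>s < N\<close>. Paying greedily, with as many
  coins \<open>N\<close> as possible, is cheapest; and raising \<open>k\<close> by one costs \<open>q + 1\<close> further coins
  \<open>N\<close> but raises the budget by only \<open>m \<le> q\<close>, so the smallest \<open>k\<close> is the best one. Hence \<open>n\<close> is a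
  gap iff \<open>k * m < u + s\<close> (\<open>point_in_semigroup_iff\<close>).

  This turns the gaps into lattice points \<open>(k, u, s)\<close>. Since \<open>u + s \<le> q + (N - 1) = h * q * m\<close>,
  only \<open>k < h * q\<close> contributes, and the genus is the double sum over \<open>k\<close> and \<open>u\<close> of
  \<open>N - (k * m + 1 - u)\<close>, truncated at 0 in the inner subtraction and outside (\<open>card_gap_codes\<close>).
  It is evaluated in \<open>gap_count\<close>. The largest gap (\<open>Max_gap\<close>) has the largest
  level \<open>k = h * q - 1\<close>, then the smallest \<open>u\<close> and the smallest \<open>s\<close> that still give a gap.
\<close>

section \<open>Sums of generators\<close>

lemma split_degree:
  fixes i j k m :: nat
  assumes "i + j \<le> Suc k * m"
  obtains i\<^sub>1 j\<^sub>1 i\<^sub>2 j\<^sub>2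
  where "i = i\<^sub>1 + i\<^sub>2" "j = j\<^sub>1 + j\<^sub>2" "i\<^sub>1 + j\<^sub>1 \<le> m" "i\<^sub>2 + j\<^sub>2 \<le> k * m"
proof
  let ?i = "min i m" and ?j = "min j (m - min i m)"
  show "i = ?i + (i - ?i)" "j = ?j + (j - ?j)" "?i + ?j \<le> m" by simp_all
  show "(i - ?i) + (j - ?j) \<le> k * m" using assms by (auto simp: min_def)
qed

lemma fits_multiple:
  fixes L N m :: nat
  assumes fits: "\<And>i j. i + j \<le> m \<Longrightarrow> i * N + j \<le> L" and "i + j \<le> k * m"
  shows "i * N + j \<le> k * L"
  using assms(2)
proof (induction k arbitrary: i j)
  case (Suc k)
  obtain i\<^sub>1 j\<^sub>1 i\<^sub>2 j\<^sub>2 where split: "i = i\<^sub>1 + i\<^sub>2" "j = j\<^sub>1 + j\<^sub>2" "i\<^sub>1 + j\<^sub>1 \<le> m" "i\<^sub>2 + j\<^sub>2 \<le> k * m"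
    using split_degree[OF Suc.prems] .
  show ?case
    using fits[OF split(3)] Suc.IH[OF split(4)] unfolding split(1,2) by (simp add: add_mult_distrib)
qed simp

text \<open>
  Degree pairs add up along sums, and by \<open>split_degree\<close> every pair within the budget of \<open>k\<close>
  generators can be peeled off one generator at a time. Writing the difference additively keeps
  the statement free of truncated subtraction.
\<close>
lemma generated_semigroup_iff:
  fixes L N m n :: nat
  assumes fits: "\<And>i j. i + j \<le> m \<Longrightarrow> i * N + j \<le> L"
  shows "n \<in> generated_semigroup {L - i * N - j | i j. i + j \<le> m} \<longleftrightarrow>
    (\<exists>k i j. i + j \<le> k * m \<and> n + i * N + j = k * L)"
    (is "n \<in> generated_semigroup ?A \<longleftrightarrow> ?R n")
proof
  assume "n \<in> generated_semigroup ?A"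
  then show "?R n"
  proof (induction rule: generated_semigroup.induct)
    case zero
    show ?case by (intro exI[of _ 0]) simp
  next
    case (gen a)
    then obtain i j where ij: "i + j \<le> m" "a = L - i * N - j" by blast
    with fits[OF ij(1)] have "i + j \<le> 1 * m \<and> a + i * N + j = 1 * L" by simp
    then show ?case by blast
  next
    case (add x y)
    then obtain k i j k' i' j' where
      "i + j \<le> k * m" "x + i * N + j = k * L"
      "i' + j' \<le> k' * m" "y + i' * N + j' = k' * L" by blast
    then have "(i + i') + (j + j') \<le> (k + k') * m \<and>
      (x + y) + (i + i') * N + (j + j') = (k + k') * L"
      by (simp add: algebra_simps)
    then show ?case by blast
  qed
next
  have "i + j \<le> k * m \<Longrightarrow> n + i * N + j = k * L \<Longrightarrow> n \<in> generated_semigroup ?A" for n i j k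
  proof (induction k arbitrary: n i j)
    case 0
    then show ?case by (simp add: generated_semigroup.zero)
  next
    case (Suc k)
    obtain i\<^sub>1 j\<^sub>1 i\<^sub>2 j\<^sub>2 where split: "i = i\<^sub>1 + i\<^sub>2" "j = j\<^sub>1 + j\<^sub>2" "i\<^sub>1 + j\<^sub>1 \<le> m" "i\<^sub>2 + j\<^sub>2 \<le> k * m"
      using split_degree[OF Suc.prems(1)] .
    define a where "a = L - i\<^sub>1 * N - j\<^sub>1"
    define n' where "n' = k * L - i\<^sub>2 * N - j\<^sub>2"
    have a: "a + i\<^sub>1 * N + j\<^sub>1 = L" using fits[OF split(3)] by (simp add: a_def)
    have n': "n' + i\<^sub>2 * N + j\<^sub>2 = k * L"
      using fits_multiple[OF fits split(4)] by (simp add: n'_def)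
    have "a \<in> generated_semigroup ?A"
      using split(3) by (intro generated_semigroup.gen) (auto simp: a_def)
    moreover have "n' \<in> generated_semigroup ?A" by (rule Suc.IH[OF split(4) n'])
    moreover have "n = a + n'"
      using Suc.prems(2) a n' unfolding split(1,2) by (simp add: add_mult_distrib)
    ultimately show ?case by (simp add: generated_semigroup.add)
  qed
  then show "?R n \<Longrightarrow> n \<in> generated_semigroup ?A" by blast
qed

section \<open>Coordinates for the positive integers\<close>

lemma ceiling_division:
  fixes n M :: nat
  assumes "0 < n" "0 < M"
  obtains t s where "0 < t" "s < M" "n + s = t * M"
proof
  show "0 < Suc ((n - 1) div M)" by simp
  show "M - 1 - (n - 1) mod M < M" using assms by simp
  have "(n - 1) mod M < M" using assms by simp
  moreover have "(n - 1) div M * M + (n - 1) mod M = n - 1" by (rule div_mult_mod_eq)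
  ultimately show "n + (M - 1 - (n - 1) mod M) = Suc ((n - 1) div M) * M"
    unfolding mult_Suc using assms by linarith
qed

lemma ceiling_division_unique:
  fixes t s t' s' M :: nat
  assumes "t * M + s' = t' * M + s" "s < M" "s' < M"
  shows "t = t'" "s = s'"
proof -
  have "t = (t * M + s') div M" "s' = (t * M + s') mod M"
    using \<open>s' < M\<close> by simp_all
  moreover have "t' = (t' * M + s) div M" "s = (t' * M + s) mod M"
    using \<open>s < M\<close> by simp_all
  ultimately show "t = t'" "s = s'" using assms(1) by simp_all
qed

text \<open>
  The coordinates are a mixed-radix expansion read downwards from the next multiple \<open>k * L\<close> of
  \<open>L = (q + 1) * N\<close>: \<open>u\<close> is the digit of weight \<open>N\<close> and \<open>s\<close> the digit of weight 1. Counting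
  downwards is what makes them match the shape of the generators.
\<close>
definition point :: "nat \<Rightarrow> nat \<Rightarrow> nat \<times> nat \<times> nat \<Rightarrow> nat" where
  "point q N = (\<lambda>(k, u, s). k * ((q + 1) * N) - u * N - s)"

lemma point_eq:
  assumes "0 < k" "u \<le> q" "s < N"
  shows "point q N (k, u, s) + u * N + s = k * ((q + 1) * N)"
proof -
  have "u * N + s \<le> q * N + N" using assms by (intro add_mono mult_right_mono) auto
  also have "\<dots> \<le> k * ((q + 1) * N)" using assms(1) by (cases k) simp_all
  finally show ?thesis by (simp add: point_def)
qed

lemma point_gt:
  assumes "0 < k" "u \<le> q" "s < N"
  shows "(k - 1) * ((q + 1) * N) < point q N (k, u, s)"
proof -
  have "u * N + s < q * N + N" using assms by (intro add_le_less_mono mult_right_mono) auto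
  also have "q * N + N + (k - 1) * ((q + 1) * N) = k * ((q + 1) * N)"
    using assms(1) by (cases k) simp_all
  finally show ?thesis using point_eq[OF assms] by linarith
qed

lemma point_surj:
  assumes "0 < n" "0 < N"
  obtains k u s where "0 < k" "u \<le> q" "s < N" "n = point q N (k, u, s)"
proof -
  obtain t s where t: "0 < t" "s < N" "n + s = t * N"
    using ceiling_division[OF assms] .
  obtain k u where k: "0 < k" "u < q + 1" "t + u = k * (q + 1)"
    using ceiling_division[OF t(1), of "q + 1"] by auto
  have "n + s + u * N = k * ((q + 1) * N)"
    using t(3) k(3) by (metis add_mult_distrib mult.assoc)
  then show thesis using that[of k u s] point_eq[of k u q s N] k t by auto
qed

lemma point_inj:
  assumes k: "0 < k" "u \<le> q" "s < N" and k': "0 < k'" "u' \<le> q" "s' < N"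
    and eq: "point q N (k, u, s) = point q N (k', u', s')"
  shows "k = k' \<and> u = u' \<and> s = s'"
proof -
  have "(k * (q + 1) + u') * N + s' = (k' * (q + 1) + u) * N + s"
    using point_eq[OF k] point_eq[OF k'] eq by (simp add: algebra_simps)
  note * = ceiling_division_unique[OF this k(3) k'(3)]
  show ?thesis
    using ceiling_division_unique[OF *(1)] k(2) k'(2) *(2) by simp
qed

text \<open>
  A representation at a level \<open>k' = k + e\<close> has to bridge \<open>e\<close> further blocks of length
  \<open>(q + 1) * N\<close>. Exchanging \<open>d\<close> coins \<open>N\<close> for \<open>d * N\<close> coins 1 never saves coins, so it costs at
  least \<open>e * (q + 1) + u + s\<close>, while the budget grows by only \<open>e * m\<close>. Hence nothing is gained over
  \<open>e = 0\<close>, \<open>i = u\<close>, \<open>j = s\<close>.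
\<close>
lemma point_in_semigroup_iff:
  assumes "m \<le> q" and k: "0 < k" "u \<le> q" "s < N"
  shows "(\<exists>k' i j. i + j \<le> k' * m \<and> point q N (k, u, s) + i * N + j = k' * ((q + 1) * N))
    \<longleftrightarrow> u + s \<le> k * m"
proof
  assume "\<exists>k' i j. i + j \<le> k' * m \<and> point q N (k, u, s) + i * N + j = k' * ((q + 1) * N)"
  then obtain k' i j where *: "i + j \<le> k' * m"
    "point q N (k, u, s) + i * N + j = k' * ((q + 1) * N)" by blast
  \<comment> \<open>The point exceeds \<open>(k - 1) * L\<close>, and a representation at level \<open>k'\<close> is at most \<open>k' * L\<close>.\<close>
  have "(k - 1) * ((q + 1) * N) < k' * ((q + 1) * N)"
    using point_gt[OF k] * by linarith
  then have "k - 1 < k'" by (metis mult_less_cancel2)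
  then obtain e where e: "k' = k + e" using k(1) by (metis Suc_pred' Suc_leI le_Suc_ex)
  have eq: "i * N + j = (e * (q + 1) + u) * N + s"
    using *(2) point_eq[OF k] by (simp add: e algebra_simps)
  have "i \<le> e * (q + 1) + u"
  proof (rule ccontr)
    assume "\<not> i \<le> e * (q + 1) + u"
    then have "(e * (q + 1) + u + 1) * N \<le> i * N" by (intro mult_right_mono) auto
    then have "(e * (q + 1) + u) * N + N \<le> i * N" by (simp add: add_mult_distrib)
    then show False using eq k(3) by linarith
  qed
  then obtain d where d: "e * (q + 1) + u = i + d" by (metis le_Suc_ex)
  then have "j = d * N + s" using eq by (simp add: add_mult_distrib)
  moreover have "d \<le> d * N" using k(3) by simp
  ultimately have "e * (q + 1) + u + s \<le> i + j" using d by linarith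
  also have "\<dots> \<le> k * m + e * m" using *(1) by (simp add: e add_mult_distrib)
  finally have "e * (q + 1) + u + s \<le> k * m + e * m" .
  moreover have "e * m \<le> e * (q + 1)" using assms(1) by (intro mult_le_mono2) simp
  ultimately show "u + s \<le> k * m" by linarith
next
  assume "u + s \<le> k * m"
  then show "\<exists>k' i j. i + j \<le> k' * m \<and> point q N (k, u, s) + i * N + j = k' * ((q + 1) * N)"
    using point_eq[OF k] by blast
qed

section \<open>The gaps as lattice points\<close>

text \<open>
  The nested intervals, rather than the condition \<open>k * m < u + s\<close>, make the set visibly finite and
  let its cardinality be read off as a double sum. Truncation of \<open>Suc (k * m) - u\<close> at 0 is
  intended: for \<open>u > k * m\<close> every \<open>s\<close> gives a gap.
\<close>
definition gap_codes :: "nat \<Rightarrow> nat \<Rightarrow> (nat \<times> nat \<times> nat) set" where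
  "gap_codes m h = (let q = m * h in
     SIGMA k:{1..<h * q}. SIGMA u:{..q}. {Suc (k * m) - u..<q * (q - 1) + 1})"

text \<open>
  The bound \<open>k < h * q\<close> is automatic for gaps: \<open>u + s\<close> is at most \<open>q + q * (q - 1) = h * q * m\<close>.
\<close>
lemma mem_gap_codes_iff:
  assumes "0 < m" "q = m * h" "N = q * (q - 1) + 1"
  shows "(k, u, s) \<in> gap_codes m h \<longleftrightarrow> 0 < k \<and> u \<le> q \<and> s < N \<and> k * m < u + s"
proof -
  have "k < h * q" if "u \<le> q" "s < N" "k * m < u + s"
  proof -
    have "k * m < q + q * (q - 1)" using that assms(3) by simp
    also have "\<dots> = q * q" by (cases q) simp_all
    also have "\<dots> = (h * q) * m" using assms(2) by simp
    finally show ?thesis by simp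
  qed
  then show ?thesis unfolding gap_codes_def Let_def assms(2,3) by auto
qed

lemma gaps_eq_image:
  assumes m: "0 < m" "m \<le> q" and q: "q = m * h" "N = q * (q - 1) + 1"
    and S: "\<And>n. n \<in> S \<longleftrightarrow>
      (\<exists>k i j. i + j \<le> k * m \<and> n + i * N + j = k * ((q + 1) * N))"
  shows "gaps S = point q N ` gap_codes m h"
proof (intro set_eqI iffI)
  fix n assume "n \<in> gaps S"
  then have n: "n \<notin> S" by (simp add: gaps_def)
  have "0 \<in> S" unfolding S by (intro exI[of _ 0]) simp
  then have "0 < n" using n by (cases n) auto
  then obtain k u s where k: "0 < k" "u \<le> q" "s < N" "n = point q N (k, u, s)"
    using point_surj[of n N q] q(2) by auto
  have "\<not> u + s \<le> k * m"
    using n point_in_semigroup_iff[OF m(2) k(1-3)] unfolding k(4) S by blast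
  then have "(k, u, s) \<in> gap_codes m h"
    using k mem_gap_codes_iff[OF m(1) q] by (simp add: not_le)
  then show "n \<in> point q N ` gap_codes m h" using k(4) by blast
next
  fix n assume "n \<in> point q N ` gap_codes m h"
  then obtain k u s where k: "(k, u, s) \<in> gap_codes m h" "n = point q N (k, u, s)"
    by (metis imageE prod_cases3)
  then have "0 < k" "u \<le> q" "s < N" "k * m < u + s"
    using mem_gap_codes_iff[OF m(1) q] by auto
  then show "n \<in> gaps S"
    using point_in_semigroup_iff[OF m(2), of k u s N] k(2) by (simp add: gaps_def S)
qed

lemma card_gap_codes:
  assumes m: "0 < m" and q: "q = m * h" "N = q * (q - 1) + 1"
  shows "card (point q N ` gap_codes m h) =
    (\<Sum>k=1..<h * q. \<Sum>u\<le>q. N - (Suc (k * m) - u))"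
proof -
  have "inj_on (point q N) (gap_codes m h)"
  proof (rule inj_onI)
    fix x y assume "x \<in> gap_codes m h" "y \<in> gap_codes m h" "point q N x = point q N y"
    then show "x = y"
      using mem_gap_codes_iff[OF m q] point_inj
      by (cases x; cases y) (metis (no_types, lifting))
  qed
  then have "card (point q N ` gap_codes m h) = card (gap_codes m h)" by (rule card_image)
  then show ?thesis unfolding gap_codes_def Let_def q by simp
qed

section \<open>The genus\<close>

lemma sum_staircase:
  fixes x q :: nat
  assumes "x \<le> q + 1"
  shows "2 * (\<Sum>u\<le>q. x - u) = x * (x + 1)"
  using assms
proof (induction q arbitrary: x)
  case 0
  then have "x = 0 \<or> x = 1" by linarith
  then show ?case by auto
next
  case (Suc q)
  show ?case
  proof (cases x)
    case (Suc y)
    then show ?thesis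
      using Suc.IH[of y] Suc.prems by (simp add: sum.atMost_Suc_shift algebra_simps del: sum.atMost_Suc)
  qed simp
qed

lemma sum_trapezoid:
  fixes x q :: nat
  assumes "q \<le> x"
  shows "2 * int (\<Sum>u\<le>q. x - u) = (int q + 1) * (2 * int x - int q)"
  using assms
proof (induction q)
  case (Suc q)
  then show ?case by (simp add: of_nat_diff algebra_simps)
qed simp

lemma column_complement:
  fixes x q N :: nat
  assumes "x \<le> N"
  shows "int (\<Sum>u\<le>q. N - (x - u)) = (int q + 1) * int N - int (\<Sum>u\<le>q. x - u)"
proof -
  have "(\<Sum>u\<le>q. N - (x - u)) + (\<Sum>u\<le>q. x - u) = (\<Sum>u\<le>q. N)"
    unfolding sum.distrib[symmetric] using assms by (intro sum.cong) auto
  then have "int (\<Sum>u\<le>q. N - (x - u)) + int (\<Sum>u\<le>q. x - u) = (int q + 1) * int N"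
    unfolding of_nat_add[symmetric] by (simp add: distrib_right)
  then show ?thesis by linarith
qed

text \<open>
  Close to the top level only a triangle of gaps is left. It has side \<open>y\<close> where the triangle of
  non-gaps at the level \<open>k\<close> with \<open>k * m = y\<close> has side \<open>y + 1\<close>; pairing the two levels cancels
  the quadratic terms.
\<close>
lemma column_high:
  fixes y q N :: nat
  assumes N: "N = q * (q - 1) + 1" and "x + y = q * q" "y \<le> q"
  shows "2 * (\<Sum>u\<le>q. N - (Suc x - u)) = y * (y + 1)"
proof -
  have qq: "q * q = q * (q - 1) + q" and le: "q \<le> q * (q - 1) + 1"
    by (cases q; simp)+
  have "(\<Sum>u\<le>q. N - (Suc x - u)) = (\<Sum>u\<le>q. u - (q - y))"
  proof (rule sum.cong)
    fix u assume "u \<in> {..q}"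
    then have "u \<le> q" by simp
    then show "N - (Suc x - u) = u - (q - y)" using assms qq le by linarith
  qed simp
  \<comment> \<open>Reversing the order of summation turns this into a staircase of height \<open>y\<close>.\<close>
  also have "\<dots> = (\<Sum>u\<le>q. (q - u) - (q - y))"
    by (simp only: atMost_atLeast0) (subst sum.atLeastAtMost_rev, simp)
  also have "\<dots> = (\<Sum>u\<le>q. y - u)"
    by (rule sum.cong) (use assms in auto)
  finally show ?thesis using sum_staircase[of y q] assms(3) by simp
qed

lemma sum_low_high:
  fixes f :: "nat \<Rightarrow> int"
  assumes "1 \<le> h" "2 \<le> q"
  shows "(\<Sum>k=1..<h * q. f k) =
    (\<Sum>k=1..<h. f k + f (h * q - k)) + (\<Sum>k=h..h * q - h. f k)"
proof -
  have le: "h + h \<le> h * q" using mult_le_mono2[OF assms(2), of h] by (simp only: mult_2_right)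
  have split: "(\<Sum>k=a..<c. f k) = (\<Sum>k=a..<b. f k) + (\<Sum>k=b..<c. f k)"
    if "a \<le> b" "b \<le> c" for a b c
    using that by (rule sum.atLeastLessThan_concat[symmetric])
  have "(\<Sum>k=1..<h * q. f k) = (\<Sum>k=1..<h. f k) + (\<Sum>k=h..<Suc (h * q - h). f k)
      + (\<Sum>k=Suc (h * q - h)..<h * q. f k)"
    using split[of 1 h "h * q"] split[of h "Suc (h * q - h)" "h * q"] le assms(1) by linarith
  also have "(\<Sum>k=Suc (h * q - h)..<h * q. f k) = (\<Sum>k=1..<h. f (h * q - k))"
    using le assms(1)
    by (intro sum.reindex_bij_witness[of _ "\<lambda>k. h * q - k" "\<lambda>k. h * q - k"]) auto
  finally show ?thesis by (simp add: sum.distrib atLeastLessThanSuc_atLeastAtMost)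
qed

lemma sum_arith_low:
  "2 * (\<Sum>k=1..<h. a - (int k * m + 1)) = (int h - 1) * (2 * a - 2 - int h * m)" if "1 \<le> h"
  using that
proof (induction h rule: dec_induct)
  case (step n)
  then show ?case by (simp add: algebra_simps)
qed simp

lemma sum_arith_mid:
  "2 * (\<Sum>k=a..b. int k) = (int b - int a + 1) * (int a + int b)" if "a \<le> b"
  using that
proof (induction b rule: dec_induct)
  case (step n)
  then show ?case by (simp add: algebra_simps)
qed simp

text \<open>
  Let \<open>G k\<close> be the number of gaps at level \<open>k\<close>. For \<open>h \<le> k \<le> h * q - h\<close> neither truncation in the
  inner sum is active, and \<open>G k\<close> is linear in \<open>k\<close>. Below that range the non-gaps form a triangle and
  above it the gaps do; the sums \<open>G k + G (h * q - k)\<close> of mirror levels are again linear in \<open>k\<close>.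
\<close>
lemma gap_count:
  fixes m h q N :: nat
  assumes m: "0 < m" "0 < h" "2 \<le> q" and q: "q = m * h" "N = q * (q - 1) + 1"
  shows "2 * int (\<Sum>k=1..<h * q. \<Sum>u\<le>q. N - (Suc (k * m) - u)) =
    int h * int q ^ 4 - int q ^ 3 - int h * int q ^ 2 + int h * int q"
proof -
  define G where "G k = int (\<Sum>u\<le>q. N - (Suc (k * m) - u))" for k
  have N: "int N = int q * int q - int q + 1" using m(3) q(2) by (simp add: of_nat_diff algebra_simps)
  have qN: "q + 1 \<le> N" using m(3) q(2) by (cases q) simp_all
  have mid: "2 * G k = 2 * (int q + 1) * int N - (int q + 1) * (2 * (int k * int m) + 2 - int q)"
    if "k \<in> {h..h * q - h}" for k
  proof -
    have "h * m \<le> k * m" using that by simp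
    then have 1: "q \<le> k * m" using q(1) by (simp add: mult.commute)
    have "k * m \<le> (h * q - h) * m" using that by simp
    also have "\<dots> = q * (q - 1)" by (simp add: q(1) algebra_simps)
    finally have 2: "Suc (k * m) \<le> N" using q(2) by simp
    show ?thesis
      unfolding G_def column_complement[OF 2]
      using sum_trapezoid[of q "Suc (k * m)"] 1 by (simp add: algebra_simps)
  qed
  have pair: "G k + G (h * q - k) = (int q + 1) * int N - (int k * int m + 1)"
    if "k \<in> {1..<h}" for k
  proof -
    have "k * m \<le> h * m" using that by simp
    then have le: "k * m \<le> q" using q(1) by (simp add: mult.commute)
    have "h \<le> h * q" using m by simp
    then have "k \<le> h * q" using that by (simp only: atLeastLessThan_iff) linarith
    then have "(h * q - k) * m + k * m = h * q * m" by (simp flip: add_mult_distrib)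
    also have "\<dots> = q * q" by (simp add: q(1))
    finally have high: "(h * q - k) * m + k * m = q * q" .
    have "2 * G (h * q - k) = int (k * m * (k * m + 1))"
      unfolding G_def by (subst column_high[OF q(2) high le, symmetric]) simp
    moreover have "2 * G k = 2 * (int q + 1) * int N - int (Suc (k * m) * (Suc (k * m) + 1))"
    proof -
      have "G k = (int q + 1) * int N - int (\<Sum>u\<le>q. Suc (k * m) - u)"
        unfolding G_def using le qN by (intro column_complement) simp
      moreover have "2 * int (\<Sum>u\<le>q. Suc (k * m) - u) = int (Suc (k * m) * (Suc (k * m) + 1))"
        using le by (subst sum_staircase[symmetric]) simp_all
      ultimately show ?thesis by linarith
    qed
    ultimately show ?thesis by (simp add: algebra_simps)
  qed
  have mid_sum: "2 * (\<Sum>k=h..h * q - h. G k) =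
      (int h * int q - 2 * int h + 1) *
      (2 * (int q + 1) * int N - (int q + 1) * (int q * int q + 2 - int q))"
  proof -
    define X where "X = int h * int q - 2 * int h"
    have le: "h + h \<le> h * q" using mult_le_mono2[OF m(3), of h] by (simp only: mult_2_right)
    have "int (h * q - h) = int (h * q) - int h" using le by (intro of_nat_diff) linarith
    then have diff: "int (h * q - h) = int h * int q - int h" by simp
    have le': "h \<le> h * q - h" using le by linarith
    then have "2 * (\<Sum>k=h..h * q - h. int k) =
        (int h * int q - int h - int h + 1) * (int h + (int h * int q - int h))"
      unfolding diff[symmetric] by (rule sum_arith_mid)
    also have "\<dots> = (X + 1) * (int h * int q)"
      by (rule arg_cong2[of _ _ _ _ times]) (simp_all add: X_def)
    finally have sum_k: "2 * (\<Sum>k=h..h * q - h. int k) = (X + 1) * (int h * int q)" .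
    have "card {h..h * q - h} + h = Suc (h * q - h)"
      unfolding card_atLeastAtMost using le' by linarith
    then have "int (card {h..h * q - h}) + int h = int (h * q - h) + 1"
      by (metis of_nat_add of_nat_Suc add.commute)
    then have "int (card {h..h * q - h}) = int h * int q - int h + 1 - int h"
      unfolding diff by (simp only: eq_diff_eq)
    also have "\<dots> = X + 1" by (simp add: X_def)
    finally have card: "int (card {h..h * q - h}) = X + 1" .
    let ?a = "2 * (int q + 1) * int N - (int q + 1) * (2 - int q)"
    let ?b = "(int q + 1) * int m"
    have "2 * (\<Sum>k=h..h * q - h. G k) = (\<Sum>k=h..h * q - h. ?a - ?b * (2 * int k))"
      unfolding sum_distrib_left
      by (rule sum.cong[OF refl], subst mid, assumption, simp add: algebra_simps)
    also have "\<dots> = (X + 1) * ?a - ?b * (2 * (\<Sum>k=h..h * q - h. int k))"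
      by (simp only: sum_subtractf sum_constant card right_diff_distrib sum_distrib_left)
    also have "\<dots> = (X + 1) * (?a - (int q + 1) * (int q * (int m * int h)))"
      unfolding sum_k by (simp add: algebra_simps)
    finally show ?thesis by (simp add: X_def q(1) algebra_simps)
  qed
  have "2 * (\<Sum>k=1..<h. G k + G (h * q - k)) =
      2 * (\<Sum>k=1..<h. (int q + 1) * int N - (int k * int m + 1))"
    by (simp only: pair cong: sum.cong)
  also have "\<dots> = (int h - 1) * (2 * ((int q + 1) * int N) - 2 - int q)"
    by (subst sum_arith_low) (use m q in \<open>simp_all add: mult.commute\<close>)
  finally have low_sum: "2 * (\<Sum>k=1..<h. G k + G (h * q - k)) = \<dots>" .
  have "int (\<Sum>k=1..<h * q. \<Sum>u\<le>q. N - (Suc (k * m) - u)) = (\<Sum>k=1..<h * q. G k)"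
    by (simp add: G_def)
  also have "\<dots> = (\<Sum>k=1..<h. G k + G (h * q - k)) + (\<Sum>k=h..h * q - h. G k)"
    using m by (intro sum_low_high) auto
  finally show ?thesis
    using low_sum mid_sum unfolding N
    by (simp add: algebra_simps power2_eq_square power3_eq_cube power4_eq_xxxx)
qed

section \<open>The Frobenius number\<close>

text \<open>
  At the top level \<open>k = h * q - 1\<close> one has \<open>k * m = q ^ 2 - m = (N - 1) + (q - m)\<close>. As \<open>s \<le> N - 1\<close>,
  a gap needs \<open>u \<ge> q + 1 - m\<close>, and for equality it needs \<open>s = N - 1\<close>. A larger \<open>u\<close> lowers the
  point by \<open>N\<close>, which outweighs any gain in \<open>s\<close>; a smaller \<open>k\<close> lowers it by \<open>(q + 1) * N\<close>, which
  outweighs any gain in \<open>u\<close> and \<open>s\<close>.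
\<close>
lemma Max_gap:
  fixes m h q N :: nat
  assumes m: "0 < m" "0 < h" "2 \<le> q" and q: "q = m * h" "N = q * (q - 1) + 1"
  defines "F \<equiv> point q N (h * q - 1, q + 1 - m, N - 1)"
  shows "Max (point q N ` gap_codes m h) = F"
    and "F + (q + 1 - m) * N + (N - 1) = (h * q - 1) * ((q + 1) * N)"
proof -
  have mq: "m \<le> q" using m q by simp
  have "1 * 2 \<le> h * q" using m by (intro mult_mono) auto
  then have pos: "0 < h * q - 1" by simp
  then have "h * q - 1 + 1 = h * q" by linarith
  then have "(h * q - 1) * m + m = h * q * m" by (metis add_mult_distrib mult_1)
  also have "\<dots> = q * q" by (simp add: q(1))
  also have "\<dots> = q * (q - 1) + q" by (cases q) simp_all
  finally have Km: "(h * q - 1) * m + m = q * (q - 1) + q" .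
  have u: "q + 1 - m \<le> q" and s: "N - 1 < N" using m q by auto
  show F: "F + (q + 1 - m) * N + (N - 1) = (h * q - 1) * ((q + 1) * N)"
    unfolding F_def by (rule point_eq[OF pos u s])
  show "Max (point q N ` gap_codes m h) = F"
  proof (rule Max_eqI)
    show "finite (point q N ` gap_codes m h)"
      unfolding gap_codes_def Let_def by (intro finite_imageI finite_SigmaI) auto
  next
    have "(h * q - 1, q + 1 - m, N - 1) \<in> gap_codes m h"
      unfolding mem_gap_codes_iff[OF m(1) q] using pos u s Km mq q(2) by simp
    then show "F \<in> point q N ` gap_codes m h" unfolding F_def by (rule imageI)
  next
    fix n assume "n \<in> point q N ` gap_codes m h"
    then obtain k u s where n: "n = point q N (k, u, s)" and "(k, u, s) \<in> gap_codes m h"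
      by (metis imageE prod_cases3)
    then have code: "0 < k" "u \<le> q" "s < N" "k * m < u + s" "k < h * q"
      using mem_gap_codes_iff[OF m(1) q, of k u s] by (auto simp: gap_codes_def Let_def q)
    have eq: "n + u * N + s = k * ((q + 1) * N)" unfolding n by (rule point_eq[OF code(1-3)])
    show "n \<le> F"
    proof (cases "k = h * q - 1")
      case True
      then have lt: "q * (q - 1) + q < u + s + m" using code(4) Km by simp
      show ?thesis
      proof (cases "u = q + 1 - m")
        case True
        then have "N - 1 \<le> s" using lt q(2) mq by simp
        then show ?thesis using eq F True \<open>k = h * q - 1\<close> by simp
      next
        case False
        then have "Suc (q + 1 - m) \<le> u" using lt code(3) q(2) mq by simp
        then have "Suc (q + 1 - m) * N \<le> u * N" by (rule mult_right_mono) simp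
        then show ?thesis using eq F True by simp
      qed
    next
      case False
      then have "Suc k * ((q + 1) * N) \<le> (h * q - 1) * ((q + 1) * N)"
        using code(5) by (intro mult_right_mono) auto
      moreover have "Suc (q + 1 - m) * N \<le> (q + 1) * N"
        using m(1) mq by (intro mult_right_mono) auto
      ultimately show ?thesis using eq F unfolding mult_Suc by linarith
    qed
  qed
qed

section \<open>Genus and conductor of the semigroup\<close>

theorem mainTheorem5:
  fixes p b r q N :: nat and S :: "nat set"
  assumes "prime p" and "b > 0" and "r \<ge> 2"
    and "q = (p ^ b) ^ r"
    and "N = (q ^ 3 + 1) div (q + 1)"
    and "S = generated_semigroup {q ^ 3 + 1 - i * N - j | i j. i + j \<le> p ^ b}"
  shows "numerical_semigroup S \<and>
    real (genus S) =
      (real q ^ 5 - real q ^ 3 * real p ^ b - real q ^ 3 + real q ^ 2) / (2 * real p ^ b) \<and>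
    real (conductor S) =
      (real q ^ 5 - 2 * real q ^ 3 * real p ^ b + real q ^ 2 * real p ^ (2 * b)
        - real q ^ 2 * real p ^ b - real q * real p ^ (2 * b) + real q ^ 2
        + real q * real p ^ b + real p ^ (2 * b) - real p ^ b) / real p ^ b"
proof -
  define m where "m = p ^ b"
  define h where "h = m ^ (r - 1)"
  have "2 \<le> p" using assms(1) by (rule prime_ge_2_nat)
  also have "p \<le> m" unfolding m_def using assms(2) \<open>2 \<le> p\<close> by (intro self_le_power) auto
  finally have m2: "2 \<le> m" .
  have h: "0 < h" using m2 by (simp add: h_def)
  have q: "q = m * h" using assms(3,4) by (simp add: h_def m_def flip: power_Suc)
  have mq: "m \<le> q" using h q by simp
  have q2: "2 \<le> q" using m2 mq by simp
  have cube: "q ^ 3 + 1 = (q + 1) * (q * (q - 1) + 1)"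
    using q2 by (cases q) (simp_all add: power3_eq_cube algebra_simps)
  have N: "N = q * (q - 1) + 1"
    unfolding assms(5) cube by (rule nonzero_mult_div_cancel_left) simp
  have S: "n \<in> S \<longleftrightarrow>
      (\<exists>k i j. i + j \<le> k * m \<and> n + i * N + j = k * ((q + 1) * N))" for n
    unfolding assms(6) m_def[symmetric] cube N[symmetric]
    using generator_no_truncation[OF mq] assms(5) cube N
    by (intro generated_semigroup_iff) simp
  have gaps: "gaps S = point q N ` gap_codes m h"
    using gaps_eq_image[OF _ mq q N S] m2 by simp
  have "numerical_semigroup S"
    unfolding numerical_semigroup_def
  proof (intro conjI ballI)
    show "0 \<in> S" unfolding assms(6) by (rule generated_semigroup.zero)
    show "x + y \<in> S" if "x \<in> S" "y \<in> S" for x y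
      using that unfolding assms(6) by (rule generated_semigroup.add)
    have "finite (gaps S)"
      unfolding gaps gap_codes_def Let_def by (intro finite_imageI finite_SigmaI) auto
    then show "finite (UNIV - S)" by (simp only: gaps_def)
  qed
  moreover
  have qr: "real q = real m * real h" by (simp add: q)
  have m0: "real m \<noteq> 0" using m2 by simp
  have "real (genus S) =
      (real q ^ 5 - real q ^ 3 * real m - real q ^ 3 + real q ^ 2) / (2 * real m)"
  proof -
    have "2 * int (genus S) =
        int h * int q ^ 4 - int q ^ 3 - int h * int q ^ 2 + int h * int q"
      unfolding genus_def gaps
      using card_gap_codes[OF _ q N] gap_count[OF _ h q2 q N] m2 by simp
    then have "real_of_int (2 * int (genus S)) =
        real_of_int (int h * int q ^ 4 - int q ^ 3 - int h * int q ^ 2 + int h * int q)"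
      by (rule arg_cong)
    then have "real (genus S) * (2 * real m) =
        real m * (real h * real q ^ 4 - real q ^ 3 - real h * real q ^ 2 + real h * real q)"
      by simp
    also have "\<dots> = real q ^ 5 - real q ^ 3 * real m - real q ^ 3 + real q ^ 2"
      unfolding qr by (simp add: algebra_simps power_numeral_reduce)
    finally show ?thesis using m0 by (simp add: nonzero_eq_divide_eq)
  qed
  moreover have "real (conductor S) =
      (real q ^ 5 - 2 * real q ^ 3 * real m + real q ^ 2 * real m ^ 2
        - real q ^ 2 * real m - real q * real m ^ 2 + real q ^ 2
        + real q * real m + real m ^ 2 - real m) / real m"
  proof -
    define F where "F = frobenius_number S"
    have "F + (q + 1 - m) * N + (N - 1) = (h * q - 1) * ((q + 1) * N)"
      unfolding F_def frobenius_number_def gaps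
      using Max_gap[OF _ h q2 q N] m2 by simp
    then have "real (F + (q + 1 - m) * N + (N - 1)) = real ((h * q - 1) * ((q + 1) * N))"
      by (rule arg_cong)
    then have F: "real F + real (q + 1 - m) * real N + real (N - 1) =
        real (h * q - 1) * ((real q + 1) * real N)"
      by (simp only: of_nat_add of_nat_mult of_nat_1)
    have hq: "real (h * q - 1) = real h * real q - 1"
      using h q2 by (simp add: of_nat_diff)
    have qm: "real (q + 1 - m) = real q + 1 - real m"
      using mq by (simp add: of_nat_diff)
    have rN: "real N = real q * real q - real q + 1" "real (N - 1) = real q * real q - real q"
      unfolding N using q2 by (simp_all add: of_nat_diff algebra_simps)
    have "real F = (real h * real q - 1) * ((real q + 1) * (real q * real q - real q + 1))
        - (real q + 1 - real m) * (real q * real q - real q + 1) - (real q * real q - real q)"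
      using F unfolding hq qm rN by linarith
    then have "real (conductor S) * real m =
        real m * ((real h * real q - 1) * ((real q + 1) * (real q * real q - real q + 1))
        - (real q + 1 - real m) * (real q * real q - real q + 1) - (real q * real q - real q) + 1)"
      by (simp add: conductor_def F_def)
    also have "\<dots> = real q ^ 5 - 2 * real q ^ 3 * real m + real q ^ 2 * real m ^ 2
        - real q ^ 2 * real m - real q * real m ^ 2 + real q ^ 2
        + real q * real m + real m ^ 2 - real m"
      unfolding qr by (simp add: algebra_simps power_numeral_reduce)
    finally show ?thesis using m0 by (simp add: nonzero_eq_divide_eq)
  qed
  ultimately show ?thesis
    by (simp add: m_def power_mult mult.commute[of 2 b])
qed

end
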